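(* Let $n\ge1$, $\Theta\subseteq\mathsf{FORM}_n$ and $\psi\in\mathsf{FORM}_n$. Then $\Theta\models_\partial\psi$ if and only if $\{\theta_1,\dots,\theta_k\}\models_\partial\psi$ for some finite subset $\{\theta_1,\dots,\theta_k\}$ of $\Theta$.
   Context: $\mathsf{FORM}_n$ is the set of formulas of infinite-valued Łukasiewicz propositional logic in the variables $X_1,\dots,X_n$. Each $\phi\in\mathsf{FORM}_n$ determines a function $\hat\phi\colon[0,1]^n\to[0,1]$: a point $v\in[0,1]^n$ assigns $v_i$ to $X_i$ and $\hat\phi(v)$ is the truth value of $\phi$ computed with $\neg x=1-x$, $x\oplus y=\min(1,x+y)$. Differential valuation (in $\mathbb R^n$): for $0\le t\le n$, a tuple $U=(u_0,u_1,\dots,u_t)$ of vectors in $\mathbb R^n$ with $u_1,\dots,u_t$ pairwise orthogonal unit vectors, such that for all sufficiently large integers $m$ the simplex $T_{U,m}=\mathrm{conv}(u_0,\,u_0+u_1/m,\,u_0+u_1/m+u_2/m^2,\dots,u_0+u_1/m+\cdots+u_t/m^t)$ is contained in $[0,1]^n$. $U$ satisfies $\psi$ if there is $m$ such that $\hat\psi=1$ on all of $T_{U,m}$. Stable consequence: $\Theta\models_\partial\psi$ iff every differential valuation in $\mathbb R^n$ satisfying every $\theta\in\Theta$ also satisfies $\psi$. *)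

theory Defs
  imports "HOL-Analysis.Analysis"
begin

text \<open>
  Formulas in \<open>n\<close> variables are formulas over an index type \<open>'n\<close> of class \<open>finite\<close> with
  \<open>CARD('n) = n\<close>; the remaining Lukasiewicz connectives are the usual abbreviations
  in terms of negation and truncated sum.
\<close>

datatype 'n form =
    Var 'n
  | Neg "'n form"
  | Oplus "'n form" "'n form"

definition unit_cube :: "(real ^ 'n) set" where
  "unit_cube = {v. \<forall>i. 0 \<le> v $ i \<and> v $ i \<le> 1}"

text \<open>Only the values at points of \<^const>\<open>unit_cube\<close> are meaningful.\<close>

primrec truth_value :: "'n::finite form \<Rightarrow> real ^ 'n \<Rightarrow> real" where
  "truth_value (Var i) v = v $ i"
| "truth_value (Neg \<phi>) v = 1 - truth_value \<phi> v"
| "truth_value (Oplus \<phi> \<psi>) v = min 1 (truth_value \<phi> v + truth_value \<psi> v)"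

lemma truth_value_range:
  assumes "v \<in> unit_cube"
  shows "truth_value \<phi> v \<in> {0..1}"
  using assms by (induction \<phi>) (auto simp: unit_cube_def)

text \<open>
  A tuple \<open>(u\<^sub>0, \<dots>, u\<^sub>t)\<close> is a list \<open>U\<close> of length \<open>t + 1\<close>; its entry \<open>U ! 0\<close> is the base point.
\<close>

definition simplex_vertex :: "(real ^ 'n) list \<Rightarrow> nat \<Rightarrow> nat \<Rightarrow> real ^ 'n" where
  "simplex_vertex U m i = U ! 0 + (\<Sum>j=1..i. (1 / real m ^ j) *\<^sub>R U ! j)"

definition T_simplex :: "(real ^ 'n) list \<Rightarrow> nat \<Rightarrow> (real ^ 'n) set" where
  "T_simplex U m = convex hull (simplex_vertex U m ` {0..<length U})"

definition differential_valuation :: "(real ^ 'n) list \<Rightarrow> bool" where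
  "differential_valuation U \<longleftrightarrow>
     U \<noteq> [] \<and> length U - 1 \<le> CARD('n) \<and>
     (\<forall>i\<in>{1..<length U}. norm (U ! i) = 1) \<and>
     (\<forall>i\<in>{1..<length U}. \<forall>j\<in>{1..<length U}. i \<noteq> j \<longrightarrow> orthogonal (U ! i) (U ! j)) \<and>
     (\<forall>\<^sub>F m in sequentially. T_simplex U m \<subseteq> unit_cube)"

text \<open>
  The function of a formula lives on the cube, so being 1 on the simplex includes that the simplex
  lies in the cube. The case \<open>m = 0\<close>, where \<open>x / 0 = 0\<close> would collapse the simplex to its base
  point, is excluded.
\<close>

definition satisfies :: "(real ^ 'n::finite) list \<Rightarrow> 'n form \<Rightarrow> bool" where
  "satisfies U \<psi> \<longleftrightarrow>
     (\<exists>m\<ge>1. T_simplex U m \<subseteq> unit_cube \<and> (\<forall>v\<in>T_simplex U m. truth_value \<psi> v = 1))"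

definition stable_consequence :: "'n::finite form set \<Rightarrow> 'n form \<Rightarrow> bool"
    (infix \<open>\<Turnstile>\<^sub>\<partial>\<close> 50) where
  "\<Theta> \<Turnstile>\<^sub>\<partial> \<psi> \<longleftrightarrow>
     (\<forall>U :: (real ^ 'n) list.
        differential_valuation U \<and> (\<forall>\<theta>\<in>\<Theta>. satisfies U \<theta>) \<longrightarrow> satisfies U \<psi>)"

end

theory Submission
  imports Defs
begin

text \<open>
  For finite \<open>\<Theta>\<^sub>0\<close>, stable consequence is just inclusion of the sets of points of value 1. If no
  finite subset of \<open>\<Theta>\<close> entails \<open>\<psi>\<close>, enumerate \<open>\<Theta>\<close> and pick points \<open>x\<^sub>k\<close> of the cube at which the
  first \<open>k\<close> formulas have value 1 but \<open>\<psi>\<close> does not. After passing to a subsequence,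
  \<open>x\<^sub>k = u\<^sub>0 + a\<^sub>1\<^sub>k u\<^sub>1 + \<dots> + a\<^sub>t\<^sub>k u\<^sub>t\<close> with orthonormal \<open>u\<^sub>j\<close> and positive coefficients, each of
  which is negligible compared with the previous one. The sign of an affine function at \<open>x\<^sub>k\<close>, and
  likewise on the small simplices of \<open>U = (u\<^sub>0, \<dots>, u\<^sub>t)\<close>, is then the lexicographic sign of its
  coefficients along \<open>U\<close>. Every formula is affine on a small enough simplex of \<open>U\<close>, and every such
  simplex contains almost all \<open>x\<^sub>k\<close>; hence \<open>U\<close> satisfies \<open>\<Theta>\<close> but not \<open>\<psi>\<close>.
\<close>

text \<open>Countability lets a single sequence of points serve all premises at once:
  \<open>to_nat\<close> numbers the formulas.\<close>

instance form :: (countable) countable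
  by countable_datatype

section \<open>Simplices of a tuple\<close>

lemma sum_by_parts_differences:
  fixes e :: "nat \<Rightarrow> 'a::real_vector"
  shows "(\<Sum>i\<le>t. (b i - b (Suc i)) *\<^sub>R (\<Sum>j\<le>i. e j)) =
    (\<Sum>j\<le>t. b j *\<^sub>R e j) - b (Suc t) *\<^sub>R (\<Sum>j\<le>t. e j)"
  by (induction t) (simp_all add: algebra_simps)

text \<open>By Abel summation the combination is a sum of the partial sums of \<open>e\<close>,
  weighted by the successive drops of \<open>b\<close>. The drops are nonnegative and telescope to
  \<open>b 0 = 1\<close>, so this is a convex combination.\<close>

lemma decreasing_combination_in_convex:
  fixes e :: "nat \<Rightarrow> 'a::real_vector"
  assumes C: "convex C" "\<And>i. i \<le> t \<Longrightarrow> (\<Sum>j\<le>i. e j) \<in> C"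
    and b: "b 0 = 1" "\<And>j. j < t \<Longrightarrow> b (Suc j) \<le> b j" "0 \<le> b t"
  shows "(\<Sum>j\<le>t. b j *\<^sub>R e j) \<in> C"
proof -
  \<comment> \<open>The value 0 past the end makes the last drop equal to \<open>b t\<close> and
    removes the boundary term of the summation by parts.\<close>
  define b' where "b' = b(Suc t := 0)"
  have "(\<Sum>i\<le>t. (b' i - b' (Suc i)) *\<^sub>R (\<Sum>j\<le>i. e j)) \<in> C"
  proof (rule convex_sum)
    have "(\<Sum>i\<le>t. b' i - b' (Suc i)) = b' 0 - b' (Suc t)"
      by (rule sum_telescope)
    then show "(\<Sum>i\<le>t. b' i - b' (Suc i)) = 1"
      using b(1) by (simp add: b'_def)
    show "0 \<le> b' i - b' (Suc i)" if "i \<in> {..t}" for i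
      using that b(2)[of i] b(3) by (cases "i = t") (auto simp: b'_def)
  qed (use C in auto)
  also have "(\<Sum>i\<le>t. (b' i - b' (Suc i)) *\<^sub>R (\<Sum>j\<le>i. e j)) = (\<Sum>j\<le>t. b' j *\<^sub>R e j)"
    unfolding sum_by_parts_differences by (simp add: b'_def)
  also have "\<dots> = (\<Sum>j\<le>t. b j *\<^sub>R e j)"
    by (intro sum.cong) (auto simp: b'_def)
  finally show ?thesis .
qed

lemma simplex_vertex_eq: "simplex_vertex U m i = (\<Sum>j\<le>i. (1 / real m ^ j) *\<^sub>R U ! j)"
proof -
  have "{..i} = insert 0 {1..i}" by auto
  then show ?thesis by (simp add: simplex_vertex_def)
qed

text \<open>Measured in units of \<open>1 / m ^ j\<close>, the coefficients become
  \<open>a j * m ^ j\<close>. They decrease exactly when each \<open>a (Suc j)\<close> is at most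
  \<open>a j / m\<close>, and the partial sums of the rescaled vectors are the vertices.\<close>

lemma mem_T_simplexI:
  assumes "i < length U" "m \<ge> 1"
    and "a 0 = 1" "\<And>j. j < i \<Longrightarrow> a (Suc j) * real m \<le> a j" "0 \<le> a i"
  shows "(\<Sum>j\<le>i. a j *\<^sub>R U ! j) \<in> T_simplex U m"
proof -
  have "(\<Sum>j\<le>i. (a j * real m ^ j) *\<^sub>R ((1 / real m ^ j) *\<^sub>R U ! j)) \<in> T_simplex U m"
  proof (rule decreasing_combination_in_convex)
    show "convex (T_simplex U m)"
      by (simp add: T_simplex_def)
    show "(\<Sum>j\<le>l. (1 / real m ^ j) *\<^sub>R U ! j) \<in> T_simplex U m" if "l \<le> i" for l
      unfolding T_simplex_def simplex_vertex_eq[symmetric]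
      using that assms(1) by (intro hull_inc) auto
    show "a (Suc j) * real m ^ Suc j \<le> a j * real m ^ j" if "j < i" for j
      using mult_right_mono[OF assms(4)[OF that], of "real m ^ j"] by (simp add: mult_ac)
  qed (use assms in auto)
  also have "(\<Sum>j\<le>i. (a j * real m ^ j) *\<^sub>R ((1 / real m ^ j) *\<^sub>R U ! j)) = (\<Sum>j\<le>i. a j *\<^sub>R U ! j)"
    using assms(2) by (intro sum.cong) auto
  finally show ?thesis .
qed

text \<open>The coefficients of a vertex of the finer simplex have ratio 1/m', which is at most
  1/m.\<close>

lemma T_simplex_antimono:
  assumes "1 \<le> m" "m \<le> m'"
  shows "T_simplex U m' \<subseteq> T_simplex U m"
  unfolding T_simplex_def[of U m']
proof (rule hull_minimal)
  show "convex (T_simplex U m)" by (simp add: T_simplex_def)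
  have "simplex_vertex U m' i \<in> T_simplex U m" if "i < length U" for i
    unfolding simplex_vertex_eq using that assms
    by (intro mem_T_simplexI) (auto simp: field_simps)
  then show "simplex_vertex U m' ` {0..<length U} \<subseteq> T_simplex U m" by auto
qed

section \<open>Lexicographic signs\<close>

text \<open>After division by \<open>a p k\<close>, the sum tends to its leading coefficient
  \<open>c p\<close>, since the later weights are negligible against the \<open>p\<close>-th.
  Positivity is asked for \<open>k \<ge> 1\<close> because the weights \<open>1 / k ^ j\<close> of
  the simplex vertices are 0 at \<open>k = 0\<close> and \<open>j \<ge> 1\<close>.\<close>

lemma eventually_lex_pos:
  fixes a :: "nat \<Rightarrow> nat \<Rightarrow> real"
  assumes "\<And>j k. j \<le> t \<Longrightarrow> k \<ge> 1 \<Longrightarrow> 0 < a j k"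
    and "\<And>j. j < t \<Longrightarrow> (\<lambda>k. a (Suc j) k / a j k) \<longlonglongrightarrow> 0"
    and "p \<le> t" "0 < c p" "\<And>j. j < p \<Longrightarrow> c j = 0"
  shows "\<forall>\<^sub>F k in sequentially. 0 < (\<Sum>j\<le>t. a j k * c j)"
proof -
  have ratio: "(\<lambda>k. a j k / a p k) \<longlonglongrightarrow> (if j = p then 1 else 0)" if "p \<le> j" "j \<le> t" for j
    using that
  proof (induction j rule: dec_induct)
    case base
    have "\<forall>\<^sub>F k in sequentially. 1 = a p k / a p k"
      using eventually_ge_at_top[of "1::nat"]
      by eventually_elim (use assms(1)[OF \<open>p \<le> t\<close>] in force)
    then show ?case using tendsto_cong by fastforce
  next
    case (step j)
    have "(\<lambda>k. (a (Suc j) k / a j k) * (a j k / a p k)) \<longlonglongrightarrow> 0 * (if j = p then 1 else 0)"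
      using step assms(2)[of j] by (intro tendsto_mult) auto
    moreover have "\<forall>\<^sub>F k in sequentially. (a (Suc j) k / a j k) * (a j k / a p k) = a (Suc j) k / a p k"
      using eventually_ge_at_top[of "1::nat"]
    proof eventually_elim
      case (elim k)
      then show ?case using assms(1)[of j k] step by auto
    qed
    ultimately have "(\<lambda>k. a (Suc j) k / a p k) \<longlonglongrightarrow> 0"
      unfolding mult_zero_left by (rule Lim_transform_eventually)
    then show ?case using step by simp
  qed
  have "(\<lambda>k. \<Sum>j\<in>{p..t}. (a j k / a p k) * c j) \<longlonglongrightarrow> (\<Sum>j\<in>{p..t}. (if j = p then 1 else 0) * c j)"
    using ratio by (intro tendsto_sum tendsto_mult tendsto_const) auto
  also have "(\<Sum>j\<in>{p..t}. (if j = p then 1 else 0) * c j) = c p"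
    using assms(3) by (simp add: if_distrib[of "\<lambda>x. x * _"] cong: if_cong)
  finally have "\<forall>\<^sub>F k in sequentially. 0 < (\<Sum>j\<in>{p..t}. (a j k / a p k) * c j)"
    using assms(4) by (rule order_tendstoD)
  with eventually_ge_at_top[of "1::nat"] show ?thesis
  proof eventually_elim
    case (elim k)
    have "(\<Sum>j\<le>t. a j k * c j) = (\<Sum>j\<in>{p..t}. a j k * c j)"
      using assms(5) by (intro sum.mono_neutral_right) auto
    also have "\<dots> = a p k * (\<Sum>j\<in>{p..t}. (a j k / a p k) * c j)"
      using assms(1)[of p k] assms(3) elim(1) by (simp add: sum_distrib_left)
    finally show ?case
      using elim assms(1)[of p k] assms(3) by simp
  qed
qed

text \<open>Here \<open>c\<close> holds the value at the base point and the slopes along the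
  directions. Vertices with index at least \<open>p\<close> eventually have positive value, and
  those before \<open>p\<close> have value 0, whence the weak inequality; a halfspace containing all
  vertices contains the simplex.\<close>

lemma eventually_lex_nonneg_on_T_simplex:
  fixes U :: "(real ^ 'n) list"
  assumes "p < length U" "0 < c p" "\<And>j. j < p \<Longrightarrow> c j = 0"
    and c: "c 0 = d + l \<bullet> U ! 0" "\<And>j. 1 \<le> j \<Longrightarrow> c j = l \<bullet> U ! j"
  shows "\<forall>\<^sub>F m in sequentially. \<forall>v\<in>T_simplex U m. 0 \<le> d + l \<bullet> v"
proof -
  have eq: "d + l \<bullet> simplex_vertex U m i = (\<Sum>j\<le>i. (1 / real m ^ j) * c j)" for m i
    unfolding simplex_vertex_eq inner_sum_right by (simp add: sum.atMost_shift c)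
  have "\<forall>\<^sub>F m in sequentially. 0 \<le> d + l \<bullet> simplex_vertex U m i" for i
  proof (cases "p \<le> i")
    case True
    have ratio: "(\<lambda>k. (1 / real k ^ Suc j) / (1 / real k ^ j)) \<longlonglongrightarrow> 0" for j
    proof -
      have "\<forall>\<^sub>F k in sequentially. 1 / real k = (1 / real k ^ Suc j) / (1 / real k ^ j)"
        using eventually_ge_at_top[of "1::nat"] by eventually_elim simp
      with lim_1_over_n show ?thesis by (rule Lim_transform_eventually)
    qed
    have "\<forall>\<^sub>F m in sequentially. 0 < (\<Sum>j\<le>i. (1 / real m ^ j) * c j)"
      by (rule eventually_lex_pos[where p = p]) (use assms True ratio in auto)
    then show ?thesis by eventually_elim (simp add: eq)
  next
    case False
    then have "(\<Sum>j\<le>i. (1 / real m ^ j) * c j) = 0" for m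
      using assms(3) by (intro sum.neutral) auto
    then show ?thesis by (simp add: eq)
  qed
  then have "\<forall>\<^sub>F m in sequentially. \<forall>i\<in>{0..<length U}. 0 \<le> d + l \<bullet> simplex_vertex U m i"
    by (intro eventually_ball_finite) auto
  then show ?thesis
  proof eventually_elim
    case (elim m)
    have "T_simplex U m \<subseteq> {v. l \<bullet> v \<ge> - d}"
      unfolding T_simplex_def
    proof (rule hull_minimal)
      show "simplex_vertex U m ` {0..<length U} \<subseteq> {v. l \<bullet> v \<ge> - d}"
      proof safe
        fix i assume "i \<in> {0..<length U}"
        with elim have "0 \<le> d + l \<bullet> simplex_vertex U m i" by blast
        then show "l \<bullet> simplex_vertex U m i \<ge> - d" by linarith
      qed
    qed (rule convex_halfspace_ge)
    then show ?case by fastforce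
  qed
qed

lemma affine_zero_on_T_simplex:
  fixes U :: "(real ^ 'n) list"
  assumes "\<And>j. j < length U \<Longrightarrow> c j = 0"
    and c: "c 0 = d + l \<bullet> U ! 0" "\<And>j. 1 \<le> j \<Longrightarrow> c j = l \<bullet> U ! j"
    and v: "v \<in> T_simplex U m"
  shows "d + l \<bullet> v = 0"
proof -
  have eq: "d + l \<bullet> simplex_vertex U m i = (\<Sum>j\<le>i. (1 / real m ^ j) * c j)" for i
    unfolding simplex_vertex_eq inner_sum_right by (simp add: sum.atMost_shift c)
  have "T_simplex U m \<subseteq> {v. l \<bullet> v = - d}"
    unfolding T_simplex_def
  proof (rule hull_minimal)
    have "d + l \<bullet> simplex_vertex U m i = 0" if "i < length U" for i
      unfolding eq using that assms(1) by (intro sum.neutral) auto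
    then show "simplex_vertex U m ` {0..<length U} \<subseteq> {v. l \<bullet> v = - d}"
      by (auto simp: eq_neg_iff_add_eq_0 add.commute)
  qed (rule convex_hyperplane)
  with v show ?thesis by auto
qed

section \<open>Sequences along a flag, and affine functions and formulas on them\<close>

text \<open>
  \<open>x k\<close> approaches \<open>U ! 0\<close> tangentially to the flag spanned by the remaining entries of \<open>U\<close>;
  \<open>a 0\<close> is the constant 1.
\<close>

definition follows_flag :: "(real ^ 'n) list \<Rightarrow> (nat \<Rightarrow> nat \<Rightarrow> real) \<Rightarrow> (nat \<Rightarrow> real ^ 'n) \<Rightarrow> bool" where
  "follows_flag U a x \<longleftrightarrow> U \<noteq> [] \<and> (\<forall>k. a 0 k = 1) \<and>
     (\<forall>j k. j < length U \<longrightarrow> 0 < a j k) \<and>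
     (\<forall>j. Suc j < length U \<longrightarrow> (\<lambda>k. a (Suc j) k / a j k) \<longlonglongrightarrow> 0) \<and>
     (\<forall>k. x k = (\<Sum>j\<le>length U - 1. a j k *\<^sub>R U ! j))"

text \<open>For fixed \<open>m\<close> the ratios of consecutive coefficients, which tend to 0, are
  eventually below 1/m, and that is the membership criterion \<open>mem_T_simplexI\<close>.\<close>

lemma follows_flag_eventually_in_T_simplex:
  assumes "follows_flag U a x" "m \<ge> 1"
  shows "\<forall>\<^sub>F k in sequentially. x k \<in> T_simplex U m"
proof -
  have "\<forall>\<^sub>F k in sequentially. a (Suc j) k / a j k < 1 / real m" if "j < length U - 1" for j
  proof (rule order_tendstoD)
    show "(\<lambda>k. a (Suc j) k / a j k) \<longlonglongrightarrow> 0"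
      using assms that by (simp add: follows_flag_def)
  qed (use assms in auto)
  then have "\<forall>\<^sub>F k in sequentially. \<forall>j\<in>{..<length U - 1}. a (Suc j) k / a j k < 1 / real m"
    by (intro eventually_ball_finite) auto
  then show ?thesis
  proof eventually_elim
    case (elim k)
    have "a (Suc j) k * real m \<le> a j k" if "j < length U - 1" for j
    proof -
      have "a (Suc j) k / a j k < 1 / real m" "0 < a j k"
        using elim that assms by (auto simp: follows_flag_def)
      then show ?thesis using assms(2) by (simp add: field_simps)
    qed
    moreover have "x k = (\<Sum>j\<le>length U - 1. a j k *\<^sub>R U ! j)" "0 \<le> a (length U - 1) k"
      using assms(1) by (auto simp: follows_flag_def less_imp_le)
    ultimately show ?case
      using assms by (simp only:) (rule mem_T_simplexI, auto simp: follows_flag_def)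
  qed
qed

text \<open>This transfers signs between the sequence and the simplices: the first nonzero
  coefficient of the affine function along \<open>U\<close> decides both. The sign is strict on the
  sequence but only weak on the simplices, whose first vertices may lie on the zero set.\<close>

lemma affine_sign_cases:
  assumes "follows_flag U a x"
  obtains (zero) "\<And>m v. v \<in> T_simplex U m \<Longrightarrow> d + l \<bullet> v = 0"
  | (pos) "\<forall>\<^sub>F m in sequentially. \<forall>v\<in>T_simplex U m. 0 \<le> d + l \<bullet> v"
      "\<forall>\<^sub>F k in sequentially. 0 < d + l \<bullet> x k"
  | (neg) "\<forall>\<^sub>F m in sequentially. \<forall>v\<in>T_simplex U m. d + l \<bullet> v \<le> 0"
      "\<forall>\<^sub>F k in sequentially. d + l \<bullet> x k < 0"
proof -
  define c where "c j = (if j = 0 then d + l \<bullet> U ! 0 else l \<bullet> U ! j)" for j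
  have eq: "d + l \<bullet> x k = (\<Sum>j\<le>length U - 1. a j k * c j)" for k
    using assms by (auto simp: follows_flag_def inner_add_right inner_sum_right sum.atMost_shift c_def)
  have lex: "\<forall>\<^sub>F k in sequentially. 0 < (\<Sum>j\<le>length U - 1. a j k * e j)"
    if "p < length U" "0 < e p" "\<And>j. j < p \<Longrightarrow> e j = 0" for e p
    by (rule eventually_lex_pos[where p = p]) (use assms that in \<open>auto simp: follows_flag_def\<close>)
  show thesis
  proof (cases "\<exists>j<length U. c j \<noteq> 0")
    case False
    then have "d + l \<bullet> v = 0" if "v \<in> T_simplex U m" for m v
      using that by (intro affine_zero_on_T_simplex[of U c]) (auto simp: c_def)
    then show thesis by (rule zero)
  next
    case True
    define p where "p = (LEAST j. j < length U \<and> c j \<noteq> 0)"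
    have p: "p < length U" "c p \<noteq> 0"
      using LeastI_ex[OF True] by (auto simp: p_def)
    have below: "c j = 0" if "j < p" for j
      using not_less_Least[of j "\<lambda>j. j < length U \<and> c j \<noteq> 0"] that p by (auto simp: p_def)
    consider "0 < c p" | "c p < 0" using p by linarith
    then show thesis
    proof cases
      case 1
      show thesis
      proof (rule pos)
        show "\<forall>\<^sub>F m in sequentially. \<forall>v\<in>T_simplex U m. 0 \<le> d + l \<bullet> v"
          by (rule eventually_lex_nonneg_on_T_simplex[of p U c]) (use p 1 below in \<open>auto simp: c_def\<close>)
        show "\<forall>\<^sub>F k in sequentially. 0 < d + l \<bullet> x k"
          unfolding eq by (rule lex[of p c]) (use p 1 below in auto)
      qed
    next
      case 2
      have minus: "- c 0 = - d + (- l) \<bullet> U ! 0" "\<And>j. 1 \<le> j \<Longrightarrow> - c j = (- l) \<bullet> U ! j"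
        by (auto simp: c_def)
      show thesis
      proof (rule neg)
        have "\<forall>\<^sub>F m in sequentially. \<forall>v\<in>T_simplex U m. 0 \<le> - d + (- l) \<bullet> v"
          by (rule eventually_lex_nonneg_on_T_simplex[of p U "\<lambda>j. - c j"])
            (use p 2 below minus in auto)
        then show "\<forall>\<^sub>F m in sequentially. \<forall>v\<in>T_simplex U m. d + l \<bullet> v \<le> 0"
          by eventually_elim force
        have "\<forall>\<^sub>F k in sequentially. 0 < (\<Sum>j\<le>length U - 1. a j k * - c j)"
          by (rule lex[of p]) (use p 2 below in auto)
        then show "\<forall>\<^sub>F k in sequentially. d + l \<bullet> x k < 0"
          unfolding eq by eventually_elim (simp add: sum_negf)
      qed
    qed
  qed
qed

text \<open>Induction on the formula, where only truncation could break affineness. The sum of the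
  two affine functions minus 1 keeps one weak sign on all small simplices, so the minimum is there
  either constantly 1 or the plain sum.\<close>

lemma truth_value_eventually_affine:
  assumes "follows_flag U a x"
  shows "\<exists>d l. \<forall>\<^sub>F m in sequentially. \<forall>v\<in>T_simplex U m. truth_value \<phi> v = d + l \<bullet> v"
proof (induction \<phi>)
  case (Var i)
  have "truth_value (Var i) v = 0 + axis i 1 \<bullet> v" for v
    by (simp add: inner_axis')
  then show ?case
    by (intro exI[of _ 0] exI[of _ "axis i 1"] always_eventually allI ballI)
next
  case (Neg \<phi>)
  then obtain d l where
    "\<forall>\<^sub>F m in sequentially. \<forall>v\<in>T_simplex U m. truth_value \<phi> v = d + l \<bullet> v" by blast
  then have "\<forall>\<^sub>F m in sequentially. \<forall>v\<in>T_simplex U m. truth_value (Neg \<phi>) v = (1 - d) + (- l) \<bullet> v"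
    by eventually_elim simp
  then show ?case by blast
next
  case (Oplus \<phi>1 \<phi>2)
  then obtain d1 l1 d2 l2 where
    1: "\<forall>\<^sub>F m in sequentially. \<forall>v\<in>T_simplex U m. truth_value \<phi>1 v = d1 + l1 \<bullet> v" and
    2: "\<forall>\<^sub>F m in sequentially. \<forall>v\<in>T_simplex U m. truth_value \<phi>2 v = d2 + l2 \<bullet> v" by blast
  have sum: "\<forall>\<^sub>F m in sequentially. \<forall>v\<in>T_simplex U m. truth_value (Oplus \<phi>1 \<phi>2) v =
      min 1 (1 + ((d1 + d2 - 1) + (l1 + l2) \<bullet> v))"
    using 1 2 by eventually_elim (simp add: inner_add_left algebra_simps)
  have one: ?case
    if "\<forall>\<^sub>F m in sequentially. \<forall>v\<in>T_simplex U m. 0 \<le> (d1 + d2 - 1) + (l1 + l2) \<bullet> v"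
  proof -
    have "\<forall>\<^sub>F m in sequentially. \<forall>v\<in>T_simplex U m. truth_value (Oplus \<phi>1 \<phi>2) v = 1 + 0 \<bullet> v"
      using sum that by eventually_elim (auto simp: min_def)
    then show ?case by blast
  qed
  show ?case
  proof (rule affine_sign_cases[OF assms, of "d1 + d2 - 1" "l1 + l2"])
    assume "\<And>m v. v \<in> T_simplex U m \<Longrightarrow> (d1 + d2 - 1) + (l1 + l2) \<bullet> v = 0"
    then show ?case by (intro one) simp
  next
    assume "\<forall>\<^sub>F m in sequentially. \<forall>v\<in>T_simplex U m. (d1 + d2 - 1) + (l1 + l2) \<bullet> v \<le> 0"
    with sum have "\<forall>\<^sub>F m in sequentially. \<forall>v\<in>T_simplex U m.
        truth_value (Oplus \<phi>1 \<phi>2) v = (d1 + d2) + (l1 + l2) \<bullet> v"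
      by eventually_elim (auto simp: min_def)
    then show ?case by blast
  qed (rule one)
qed

section \<open>Extracting a flag from a sequence\<close>

text \<open>Induction on the dimension: the first vector \<open>u\<close> is a limit of normalized
  directions, and the part of \<open>w\<close> orthogonal to \<open>u\<close> is expanded in the
  smaller space orthogonal to \<open>u\<close>. The bound on \<open>a 0\<close> is carried along to
  compare the leading coefficient of that remainder with the coefficient of
  \<open>u\<close>.\<close>

lemma asymptotic_orthonormal_expansion:
  fixes w :: "nat \<Rightarrow> 'a::euclidean_space"
  assumes "subspace S" "\<And>k. w k \<in> S"
  shows "\<exists>us r a. strict_mono (r :: nat \<Rightarrow> nat) \<and> length us \<le> dim S \<and> set us \<subseteq> S \<and>
    (\<forall>i<length us. norm (us ! i) = 1) \<and>
    (\<forall>i<length us. \<forall>j<length us. i \<noteq> j \<longrightarrow> orthogonal (us ! i) (us ! j)) \<and>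
    (\<forall>k. w (r k) = (\<Sum>j<length us. a j k *\<^sub>R us ! j)) \<and>
    (\<forall>j<length us. \<forall>k. 0 < a j k) \<and>
    (\<forall>j. Suc j < length us \<longrightarrow> (\<lambda>k. a (Suc j) k / a j k) \<longlonglongrightarrow> 0) \<and>
    (us \<noteq> [] \<longrightarrow> (\<forall>k. a 0 k \<le> norm (w (r k))))"
  using assms
proof (induction "dim S" arbitrary: S w rule: less_induct)
  case less
  show ?case
  \<comment> \<open>A subsequence of zeros has the empty expansion, which also covers dimension 0.
    Otherwise a subsequence avoids 0 and directions exist.\<close>
  proof (cases "infinite {k. w k = 0}")
    case True
    then obtain r :: "nat \<Rightarrow> nat" where "strict_mono r" "\<And>k. w (r k) = 0"
      using infinite_enumerate by blast
    then show ?thesis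
      by (intro exI[of _ "[]"] exI[of _ r]) simp
  next
    case False
    then have "infinite {k. w k \<noteq> 0}"
      using finite_Collect_not by blast
    then obtain r0 :: "nat \<Rightarrow> nat" where r0: "strict_mono r0" "\<And>k. w (r0 k) \<noteq> 0"
      using infinite_enumerate by blast
    define dir where "dir k = w k /\<^sub>R norm (w k)" for k
    have "\<forall>k. (dir \<circ> r0) k \<in> sphere 0 1"
      using r0 by (simp add: dir_def)
    then obtain u r1 where u: "u \<in> sphere 0 1" and r1: "strict_mono r1"
      and lim: "((dir \<circ> r0) \<circ> r1) \<longlonglongrightarrow> u"
      using compact_sphere[of "0::'a" 1] unfolding compact_def by metis
    have nu: "norm u = 1" using u by simp
    then have uu: "u \<bullet> u = 1" by (simp add: dot_square_norm)
    have lim1: "(\<lambda>k. dir (r0 (r1 k)) \<bullet> u) \<longlonglongrightarrow> 1"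
      using tendsto_inner[OF lim tendsto_const[of u]] uu by (simp add: o_def)
    then have "\<forall>\<^sub>F k in sequentially. 0 < dir (r0 (r1 k)) \<bullet> u"
      by (rule order_tendstoD) simp
    then obtain N where N: "\<And>k. k \<ge> N \<Longrightarrow> 0 < dir (r0 (r1 k)) \<bullet> u"
      by (auto simp: eventually_sequentially)
    \<comment> \<open>The shift by \<open>N\<close> makes the coefficient along \<open>u\<close>
      positive at every index, not just eventually.\<close>
    define s where "s k = r0 (r1 (k + N))" for k
    have s: "strict_mono s"
      using r0(1) r1 by (simp add: s_def strict_mono_def)
    have ws: "w (s k) \<noteq> 0" for k using r0 by (simp add: s_def)
    have pos: "0 < w (s k) \<bullet> u" for k
      using N[of "k + N"] ws[of k] by (simp add: s_def dir_def zero_less_mult_iff)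
    have dir_s: "(\<lambda>k. dir (s k)) \<longlonglongrightarrow> u"
      using LIMSEQ_ignore_initial_segment[OF lim, of N] by (simp add: s_def o_def)
    define w' where "w' k = w (s k) - (w (s k) \<bullet> u) *\<^sub>R u" for k
    define S' where "S' = S \<inter> {v. u \<bullet> v = 0}"
    have "closed S" using less.prems(1) by (rule closed_subspace)
    moreover have "dir (s k) \<in> S" for k
      unfolding dir_def using less.prems by (intro subspace_scale) auto
    ultimately have uS: "u \<in> S"
      using dir_s by (meson closed_sequentially)
    have S': "subspace S'"
      unfolding S'_def using less.prems(1) by (intro subspace_inter subspace_hyperplane)
    have "u \<notin> S'" using uu by (simp add: S'_def)
    then have "S' \<subset> S" using uS unfolding S'_def by blast
    then have dim: "dim S' < dim S"
      using S' less.prems(1) by (intro dim_psubset) (simp add: span_eq_iff[THEN iffD2])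
    have w'S: "w' k \<in> S'" for k
      using less.prems uS uu
      by (auto simp: S'_def w'_def inner_diff_right inner_commute intro!: subspace_diff subspace_scale)
    obtain us r a where r: "strict_mono (r :: nat \<Rightarrow> nat)" and us: "length us \<le> dim S'" "set us \<subseteq> S'"
      "\<forall>i<length us. norm (us ! i) = 1"
      "\<forall>i<length us. \<forall>j<length us. i \<noteq> j \<longrightarrow> orthogonal (us ! i) (us ! j)"
      and a: "\<forall>k. w' (r k) = (\<Sum>j<length us. a j k *\<^sub>R us ! j)"
      "\<forall>j<length us. \<forall>k. 0 < a j k"
      "\<forall>j. Suc j < length us \<longrightarrow> (\<lambda>k. a (Suc j) k / a j k) \<longlonglongrightarrow> 0"
      "us \<noteq> [] \<longrightarrow> (\<forall>k. a 0 k \<le> norm (w' (r k)))"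
      using less.hyps[OF dim S', of w', OF w'S] by (elim exE conjE) (rule that)
    note us = us[rule_format] and a = a[rule_format]
    define b where "b j k = (case j of 0 \<Rightarrow> w (s (r k)) \<bullet> u | Suc i \<Rightarrow> a i k)" for j k
    \<comment> \<open>The ratio of the remainder to the coefficient along \<open>u\<close> is
      unchanged by scaling \<open>w\<close>, so it is a continuous function of the direction near
      \<open>u\<close>, with value 0 at \<open>u\<close>.\<close>
    have "(\<lambda>k. norm (dir (s k) - (dir (s k) \<bullet> u) *\<^sub>R u) / (dir (s k) \<bullet> u)) \<longlonglongrightarrow>
        norm (u - (u \<bullet> u) *\<^sub>R u) / (u \<bullet> u)"
      using uu by (intro tendsto_intros dir_s) simp
    moreover have "norm (dir (s k) - (dir (s k) \<bullet> u) *\<^sub>R u) / (dir (s k) \<bullet> u) =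
        norm (w' k) / (w (s k) \<bullet> u)" for k
    proof -
      have "dir (s k) - (dir (s k) \<bullet> u) *\<^sub>R u = w' k /\<^sub>R norm (w (s k))"
        by (simp add: dir_def w'_def scaleR_right_diff_distrib)
      then show ?thesis using ws[of k] by (simp add: dir_def divide_simps)
    qed
    ultimately have "(\<lambda>k. norm (w' k) / (w (s k) \<bullet> u)) \<longlonglongrightarrow> 0"
      using uu by simp
    then have small: "(\<lambda>k. norm (w' (r k)) / (w (s (r k)) \<bullet> u)) \<longlonglongrightarrow> 0"
      using LIMSEQ_subseq_LIMSEQ[OF _ r] by (force simp: o_def)
    \<comment> \<open>The norm bound from the induction hypothesis links the old leading coefficient
      to the remainder.\<close>
    have ratio0: "(\<lambda>k. a 0 k / (w (s (r k)) \<bullet> u)) \<longlonglongrightarrow> 0" if "us \<noteq> []"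
    proof (rule tendsto_sandwich[OF _ _ tendsto_const small])
      show "\<forall>\<^sub>F k in sequentially. 0 \<le> a 0 k / (w (s (r k)) \<bullet> u)"
        using a(2)[of 0] pos that by (intro always_eventually allI) (simp add: less_imp_le)
      show "\<forall>\<^sub>F k in sequentially. a 0 k / (w (s (r k)) \<bullet> u) \<le> norm (w' (r k)) / (w (s (r k)) \<bullet> u)"
        using a(4) pos that by (intro always_eventually allI divide_right_mono) (auto simp: less_imp_le)
    qed
    have orth: "orthogonal u (us ! i)" "orthogonal (us ! i) u" if "i < length us" for i
      using us(2) nth_mem[OF that] by (auto simp: S'_def orthogonal_def inner_commute)
    show ?thesis
    proof (intro exI conjI)
      show "strict_mono (s \<circ> r)" using s r by (rule strict_mono_o)
      show "length (u # us) \<le> dim S" using us(1) dim by simp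
      show "set (u # us) \<subseteq> S" using uS us(2) by (auto simp: S'_def)
      show "\<forall>i<length (u # us). norm ((u # us) ! i) = 1"
        using us(3) nu by (auto simp: nth_Cons split: nat.split)
      show "\<forall>i<length (u # us). \<forall>j<length (u # us). i \<noteq> j \<longrightarrow>
          orthogonal ((u # us) ! i) ((u # us) ! j)"
        using us(4) orth by (auto simp: nth_Cons split: nat.split)
      show "\<forall>k. w ((s \<circ> r) k) = (\<Sum>j<length (u # us). b j k *\<^sub>R (u # us) ! j)"
      proof
        fix k
        have "w (s (r k)) = (w (s (r k)) \<bullet> u) *\<^sub>R u + w' (r k)"
          by (simp add: w'_def)
        also have "\<dots> = (\<Sum>j<length (u # us). b j k *\<^sub>R (u # us) ! j)"
          unfolding a(1) list.size(4) add_Suc_right add_0_right sum.lessThan_Suc_shift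
          by (simp add: b_def)
        finally show "w ((s \<circ> r) k) = (\<Sum>j<length (u # us). b j k *\<^sub>R (u # us) ! j)"
          by simp
      qed
      show "\<forall>j<length (u # us). \<forall>k. 0 < b j k"
        using a(2) pos by (auto simp: b_def split: nat.split)
      show "\<forall>j. Suc j < length (u # us) \<longrightarrow> (\<lambda>k. b (Suc j) k / b j k) \<longlonglongrightarrow> 0"
        using a(3) ratio0
        by (intro allI, rename_tac j, case_tac j) (auto simp: b_def)
      show "u # us \<noteq> [] \<longrightarrow> (\<forall>k. b 0 k \<le> norm (w ((s \<circ> r) k)))"
        using norm_cauchy_schwarz[of _ u] nu by (simp add: b_def)
    qed
  qed
qed

section \<open>From points of the cube to a differential valuation\<close>

lemma compact_unit_cube: "compact (unit_cube :: (real ^ 'n) set)"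
proof -
  have "(unit_cube :: (real ^ 'n) set) = cbox 0 1"
    by (auto simp: unit_cube_def mem_box_cart)
  then show ?thesis by (metis compact_cbox)
qed

text \<open>Compactness supplies the base point, and the differences from it are expanded. The cube
  is cut out by finitely many affine inequalities, which pass from the points to the small
  simplices.\<close>

lemma unit_cube_subsequence_follows_flag:
  fixes x :: "nat \<Rightarrow> real ^ 'n"
  assumes "\<And>k. x k \<in> unit_cube"
  obtains U r a where "strict_mono (r :: nat \<Rightarrow> nat)" "follows_flag U a (x \<circ> r)"
    "differential_valuation U"
proof -
  obtain u0 r0 where r0: "strict_mono (r0 :: nat \<Rightarrow> nat)" and lim: "(x \<circ> r0) \<longlonglongrightarrow> u0"
    using compact_unit_cube assms unfolding compact_def by metis
  define w where "w k = x (r0 k) - u0" for k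
  obtain us r b where r: "strict_mono (r :: nat \<Rightarrow> nat)" and us: "length us \<le> CARD('n)"
    "\<forall>i<length us. norm (us ! i) = 1"
    "\<forall>i<length us. \<forall>j<length us. i \<noteq> j \<longrightarrow> orthogonal (us ! i) (us ! j)"
    and b: "\<forall>k. w (r k) = (\<Sum>j<length us. b j k *\<^sub>R us ! j)"
    "\<forall>j<length us. \<forall>k. 0 < b j k"
    "\<forall>j. Suc j < length us \<longrightarrow> (\<lambda>k. b (Suc j) k / b j k) \<longlonglongrightarrow> 0"
    "us \<noteq> [] \<longrightarrow> (\<forall>k. b 0 k \<le> norm (w (r k)))"
    using asymptotic_orthonormal_expansion[of UNIV w, OF subspace_UNIV UNIV_I]
    unfolding dim_UNIV DIM_cart DIM_real mult_1_right
    by (elim exE conjE) (rule that)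
  note us = us[rule_format] and b = b[rule_format]
  define a where "a j k = (case j of 0 \<Rightarrow> 1 | Suc i \<Rightarrow> b i k)" for j k
  define U where "U = u0 # us"
  have "(\<lambda>k. w (r k)) \<longlonglongrightarrow> u0 - u0"
    unfolding w_def using LIMSEQ_subseq_LIMSEQ[OF lim r]
    by (intro tendsto_diff tendsto_const) (simp add: o_def)
  then have w0: "(\<lambda>k. norm (w (r k))) \<longlonglongrightarrow> 0"
    by (simp add: tendsto_norm_zero)
  \<comment> \<open>The base point has weight 1, so the first ratio is \<open>b 0\<close> itself;
    the norm of the difference bounds it.\<close>
  have b0: "(\<lambda>k. b 0 k) \<longlonglongrightarrow> 0" if "us \<noteq> []"
    by (rule tendsto_sandwich[OF _ _ tendsto_const w0])
      (use b that in \<open>auto intro!: always_eventually simp: less_imp_le\<close>)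
  have flag: "follows_flag U a (x \<circ> (r0 \<circ> r))"
    unfolding follows_flag_def
  proof (intro conjI allI impI)
    show "U \<noteq> []" by (simp add: U_def)
    show "a 0 k = 1" for k by (simp add: a_def)
    show "0 < a j k" if "j < length U" for j k
      using that b(2) by (auto simp: a_def U_def split: nat.split)
    show "(\<lambda>k. a (Suc j) k / a j k) \<longlonglongrightarrow> 0" if "Suc j < length U" for j
      using that b(3) b0 by (cases j) (auto simp: a_def U_def)
    show "(x \<circ> (r0 \<circ> r)) k = (\<Sum>j\<le>length U - 1. a j k *\<^sub>R U ! j)" for k
      using b(1)[of k] by (simp add: a_def U_def sum.atMost_shift w_def algebra_simps)
  qed
  \<comment> \<open>Nonnegativity at all points of the sequence rules out the negative case of the
    sign trichotomy.\<close>
  have nonneg: "\<forall>\<^sub>F m in sequentially. \<forall>v\<in>T_simplex U m. 0 \<le> d + l \<bullet> v"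
    if "\<And>k. 0 \<le> d + l \<bullet> x k" for d l
  proof (rule affine_sign_cases[OF flag, of d l])
    assume "\<forall>\<^sub>F k in sequentially. d + l \<bullet> (x \<circ> (r0 \<circ> r)) k < 0"
    then have False using that by (simp add: not_less[symmetric])
    then show ?thesis ..
  qed auto
  have "\<forall>\<^sub>F m in sequentially. \<forall>v\<in>T_simplex U m. 0 \<le> v $ i \<and> v $ i \<le> 1" for i
  proof -
    have "\<forall>\<^sub>F m in sequentially. \<forall>v\<in>T_simplex U m. 0 \<le> 0 + axis i 1 \<bullet> v"
      using assms by (intro nonneg) (simp add: inner_axis' unit_cube_def)
    moreover have "\<forall>\<^sub>F m in sequentially. \<forall>v\<in>T_simplex U m. 0 \<le> 1 + (- axis i 1) \<bullet> v"
      using assms by (intro nonneg) (simp add: inner_axis' unit_cube_def)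
    ultimately show ?thesis
      by eventually_elim (simp add: inner_axis')
  qed
  then have "\<forall>\<^sub>F m in sequentially. \<forall>i. \<forall>v\<in>T_simplex U m. 0 \<le> v $ i \<and> v $ i \<le> 1"
    by (intro eventually_all_finite) auto
  then have cube: "\<forall>\<^sub>F m in sequentially. T_simplex U m \<subseteq> unit_cube"
    by eventually_elim (auto simp: unit_cube_def)
  have "differential_valuation U"
    unfolding differential_valuation_def
  proof (intro conjI ballI impI)
    show "norm (U ! i) = 1" if "i \<in> {1..<length U}" for i
      using that us(2)[of "i - 1"] by (auto simp: U_def nth_Cons')
    show "orthogonal (U ! i) (U ! j)"
      if "i \<in> {1..<length U}" "j \<in> {1..<length U}" "i \<noteq> j" for i j
      using that us(3)[of "i - 1" "j - 1"] by (auto simp: U_def nth_Cons')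
  qed (use us cube in \<open>auto simp: U_def\<close>)
  with flag strict_mono_o[OF r0 r] show thesis by (intro that)
qed

section \<open>Compactness\<close>

text \<open>On a small simplex \<open>\<theta>\<close> is affine, and the sequence ends up in that
  simplex. There the affine function minus 1 vanishes at almost all points, so it has neither strict
  sign and must vanish on every simplex of \<open>U\<close>.\<close>

lemma satisfies_if_eventually_true:
  assumes "differential_valuation U" "follows_flag U a x"
    and "\<forall>\<^sub>F k in sequentially. truth_value \<theta> (x k) = 1"
  shows "satisfies U \<theta>"
proof -
  obtain d l where aff: "\<forall>\<^sub>F m in sequentially. \<forall>v\<in>T_simplex U m. truth_value \<theta> v = d + l \<bullet> v"
    using truth_value_eventually_affine[OF assms(2)] by blast
  with eventually_ge_at_top[of "1::nat"]
  have "\<forall>\<^sub>F m in sequentially. m \<ge> 1 \<and> (\<forall>v\<in>T_simplex U m. truth_value \<theta> v = d + l \<bullet> v)"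
    by eventually_elim simp
  then obtain m0 where m0: "m0 \<ge> 1" "\<And>v. v \<in> T_simplex U m0 \<Longrightarrow> truth_value \<theta> v = d + l \<bullet> v"
    by (auto simp: eventually_sequentially)
  have eq1: "\<forall>\<^sub>F k in sequentially. (d - 1) + l \<bullet> x k = 0"
    using assms(3) follows_flag_eventually_in_T_simplex[OF assms(2) m0(1)]
    by eventually_elim (use m0(2) in force)
  have zero: "(d - 1) + l \<bullet> v = 0" if "v \<in> T_simplex U m" for v m
  proof (rule affine_sign_cases[OF assms(2), of "d - 1" l])
    assume "\<forall>\<^sub>F k in sequentially. 0 < d - 1 + l \<bullet> x k"
    with eq1 have "\<forall>\<^sub>F k::nat in sequentially. False" by eventually_elim simp
    then show ?thesis by simp
  next
    assume "\<forall>\<^sub>F k in sequentially. d - 1 + l \<bullet> x k < 0"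
    with eq1 have "\<forall>\<^sub>F k::nat in sequentially. False" by eventually_elim simp
    then show ?thesis by simp
  qed (use that in blast)
  have "\<forall>\<^sub>F m in sequentially. T_simplex U m \<subseteq> unit_cube"
    using assms(1) by (simp add: differential_valuation_def)
  with aff eventually_ge_at_top[of "1::nat"]
  have "\<forall>\<^sub>F m in sequentially. m \<ge> 1 \<and> T_simplex U m \<subseteq> unit_cube \<and>
      (\<forall>v\<in>T_simplex U m. truth_value \<theta> v = 1)"
    by eventually_elim (use zero in force)
  then show ?thesis
    unfolding satisfies_def by (auto simp: eventually_sequentially)
qed

text \<open>Take a valuation refuting the consequence. Its simplices are nested, so finitely many
  premises are all 1 on a common one inside the cube, and \<open>\<psi>\<close> must fail somewhere
  on it.\<close>

lemma finite_not_stable_consequence_witness: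
  fixes \<Theta> :: "'n::finite form set"
  assumes "finite \<Theta>" "\<not> \<Theta> \<Turnstile>\<^sub>\<partial> \<psi>"
  obtains x where "x \<in> unit_cube" "\<And>\<theta>. \<theta> \<in> \<Theta> \<Longrightarrow> truth_value \<theta> x = 1" "truth_value \<psi> x \<noteq> 1"
proof -
  obtain U :: "(real ^ 'n) list" where U: "differential_valuation U"
    and sat: "\<And>\<theta>. \<theta> \<in> \<Theta> \<Longrightarrow> satisfies U \<theta>" and nsat: "\<not> satisfies U \<psi>"
    using assms(2) unfolding stable_consequence_def by blast
  have "\<forall>\<^sub>F m in sequentially. \<forall>v\<in>T_simplex U m. truth_value \<theta> v = 1" if \<theta>: "\<theta> \<in> \<Theta>" for \<theta>
  proof -
    obtain m0 where m0: "m0 \<ge> 1" "\<And>v. v \<in> T_simplex U m0 \<Longrightarrow> truth_value \<theta> v = 1"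
      using sat[OF \<theta>] unfolding satisfies_def by blast
    show ?thesis
      using eventually_ge_at_top[of m0]
      by eventually_elim (use m0 T_simplex_antimono[OF m0(1)] in blast)
  qed
  then have "\<forall>\<^sub>F m in sequentially. \<forall>\<theta>\<in>\<Theta>. \<forall>v\<in>T_simplex U m. truth_value \<theta> v = 1"
    using assms(1) by (intro eventually_ball_finite) auto
  moreover have "\<forall>\<^sub>F m in sequentially. T_simplex U m \<subseteq> unit_cube"
    using U by (simp add: differential_valuation_def)
  ultimately have "\<forall>\<^sub>F m in sequentially. m \<ge> 1 \<and> T_simplex U m \<subseteq> unit_cube \<and>
      (\<forall>\<theta>\<in>\<Theta>. \<forall>v\<in>T_simplex U m. truth_value \<theta> v = 1)"
    using eventually_ge_at_top[of "1::nat"] by eventually_elim simp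
  then obtain m where m: "m \<ge> 1" "T_simplex U m \<subseteq> unit_cube"
    "\<And>\<theta> v. \<theta> \<in> \<Theta> \<Longrightarrow> v \<in> T_simplex U m \<Longrightarrow> truth_value \<theta> v = 1"
    by (auto simp: eventually_sequentially)
  then obtain v where "v \<in> T_simplex U m" "truth_value \<psi> v \<noteq> 1"
    using nsat unfolding satisfies_def by blast
  with m show thesis by (intro that[of v]) auto
qed

theorem theorem3p10:
  fixes \<Theta> :: "'n::finite form set" and \<psi> :: "'n form"
  shows "\<Theta> \<Turnstile>\<^sub>\<partial> \<psi> \<longleftrightarrow>
    (\<exists>\<Theta>\<^sub>0. finite \<Theta>\<^sub>0 \<and> \<Theta>\<^sub>0 \<subseteq> \<Theta> \<and> \<Theta>\<^sub>0 \<Turnstile>\<^sub>\<partial> \<psi>)"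
proof
  assume "\<exists>\<Theta>\<^sub>0. finite \<Theta>\<^sub>0 \<and> \<Theta>\<^sub>0 \<subseteq> \<Theta> \<and> \<Theta>\<^sub>0 \<Turnstile>\<^sub>\<partial> \<psi>"
  then show "\<Theta> \<Turnstile>\<^sub>\<partial> \<psi>"
    unfolding stable_consequence_def by blast
next
  assume cons: "\<Theta> \<Turnstile>\<^sub>\<partial> \<psi>"
  show "\<exists>\<Theta>\<^sub>0. finite \<Theta>\<^sub>0 \<and> \<Theta>\<^sub>0 \<subseteq> \<Theta> \<and> \<Theta>\<^sub>0 \<Turnstile>\<^sub>\<partial> \<psi>"
  proof (rule ccontr)
    assume none: "\<not> ?thesis"
    \<comment> \<open>Only finitely many premises have code at most \<open>k\<close>, and each
      premise is among them for almost all \<open>k\<close>.\<close>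
    have "\<exists>x. x \<in> unit_cube \<and> (\<forall>\<theta>\<in>\<Theta>. to_nat \<theta> \<le> k \<longrightarrow> truth_value \<theta> x = 1) \<and>
        truth_value \<psi> x \<noteq> 1" for k
    proof -
      have fin: "finite {\<theta> \<in> \<Theta>. to_nat \<theta> \<le> k}"
        by (rule finite_subset[OF _ finite_vimageI[OF finite_atMost[of k] inj_to_nat]]) auto
      moreover have "\<not> {\<theta> \<in> \<Theta>. to_nat \<theta> \<le> k} \<Turnstile>\<^sub>\<partial> \<psi>"
        using none fin by blast
      ultimately obtain x where "x \<in> unit_cube"
        "\<And>\<theta>. \<theta> \<in> {\<theta> \<in> \<Theta>. to_nat \<theta> \<le> k} \<Longrightarrow> truth_value \<theta> x = 1" "truth_value \<psi> x \<noteq> 1"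
        using finite_not_stable_consequence_witness by blast
      then show ?thesis by auto
    qed
    then obtain x where x: "\<And>k. x k \<in> unit_cube"
      "\<And>k \<theta>. \<theta> \<in> \<Theta> \<Longrightarrow> to_nat \<theta> \<le> k \<Longrightarrow> truth_value \<theta> (x k) = 1"
      "\<And>k. truth_value \<psi> (x k) \<noteq> 1"
      by metis
    obtain U r a where r: "strict_mono (r :: nat \<Rightarrow> nat)" and flag: "follows_flag U a (x \<circ> r)"
      and U: "differential_valuation U"
      using x(1) by (rule unit_cube_subsequence_follows_flag)
    have "satisfies U \<theta>" if "\<theta> \<in> \<Theta>" for \<theta>
    proof (rule satisfies_if_eventually_true[OF U flag])
      show "\<forall>\<^sub>F k in sequentially. truth_value \<theta> ((x \<circ> r) k) = 1"
        using eventually_ge_at_top[of "to_nat \<theta>"]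
      proof eventually_elim
        case (elim k)
        then have "to_nat \<theta> \<le> r k" using strict_mono_imp_increasing[OF r, of k] by simp
        then show ?case using x(2) that by simp
      qed
    qed
    then have "satisfies U \<psi>"
      using cons U unfolding stable_consequence_def by blast
    then obtain m where m: "m \<ge> 1" "\<And>v. v \<in> T_simplex U m \<Longrightarrow> truth_value \<psi> v = 1"
      unfolding satisfies_def by blast
    \<comment> \<open>The simplex on which \<open>\<psi>\<close> is 1 contains almost all points of
      the subsequence, yet \<open>\<psi>\<close> is 1 at none of them.\<close>
    have "\<forall>\<^sub>F k::nat in sequentially. False"
      using follows_flag_eventually_in_T_simplex[OF flag m(1)]
      by eventually_elim (use m(2) x(3) in force)
    then show False by simp
  qed
qed

end
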